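(* Let $k\ge 1$ be an integer and let the memory kernel be $g(t)=\sum_{j=1}^{k+1}\theta_j\, g_j(t)$ with $\boldsymbol{\theta}=(\theta_1,\dots,\theta_{k+1})\in\mathbb{R}^{k+1}$, $\theta_1>0$ and $\theta_j\ge 0$ for every $j$. Let $\Lambda(\xi)$, $\xi\in\mathbb{R}$, be the set of roots of the associated dispersion relation. If $$\sum_{j=2}^{k+1}\theta_j<\theta_1,$$ then there exists $c_0>0$ such that $$\mathrm{Re}\,\lambda\le-\frac{c_0|\xi|^2}{1+|\xi|^2}\qquad\text{for all }\xi\in\mathbb{R}\text{ and all }\lambda\in\Lambda(\xi).$$
   Context: For integers $j\ge1$, $g_j(t)=\frac{1}{(j-1)!}t^{j-1}e^{-t}$ ($t\ge 0$) is the Gamma distribution with shape $j$ and scale $\tau=1$. For a kernel $g=\sum_{j=1}^{k+1}\theta_j g_j$, the memory diffusion equation $\partial_t u(x,t)-\int_{-\infty}^t g(t-s)\,\partial_{xx}u(x,s)\,ds=0$ is equivalent to the system, for $(u,\mathbf{v})\in\mathbb{R}^{k+2}$, $$\partial_t u+\partial_x(\boldsymbol{\theta}\cdot\mathbf{v})=0,\qquad \partial_t\mathbf{v}+\mathbf{e}_1\,\partial_x u+(\mathbb{I}_{k+1}-\mathbb{N}_{k+1})\mathbf{v}=0,$$ where $\mathbf{e}_1=(1,0,\dots,0)\in\mathbb{R}^{k+1}$, $\mathbb{I}_{k+1}$ is the identity matrix and $\mathbb{N}_{k+1}$ is the $(k+1)\times(k+1)$ matrix with $1$ on the subdiagonal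 and $0$ elsewhere. For $\lambda,\mu\in\mathbb{C}$ set $$p(\lambda,\mu):=\det\begin{pmatrix}\lambda & \mu\,\boldsymbol{\theta}\\ \mu\,\mathbf{e}_1 & (\lambda+1)\mathbb{I}_{k+1}-\mathbb{N}_{k+1}\end{pmatrix}$$ (a $(k+2)\times(k+2)$ determinant, with $\boldsymbol{\theta}$ regarded as a row and $\mathbf{e}_1$ as a column). The dispersion relation is $p(\lambda,\mu)=0$, and $\Lambda(\xi):=\{\lambda\in\mathbb{C} : p(\lambda,i\xi)=0\}$ for $\xi\in\mathbb{R}$. *)

theory Defs
  imports Complex_Main "Jordan_Normal_Form.Determinant"
begin

text \<open>The kernels are functions of \<^term>\<open>t \<ge> 0\<close>; their values at negative \<open>t\<close> carry no meaning.\<close>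

definition gamma_kernel :: "nat \<Rightarrow> real \<Rightarrow> real" where
  "gamma_kernel j t = 1 / fact (j - 1) * t ^ (j - 1) * exp (- t)"

definition memory_kernel :: "nat \<Rightarrow> (nat \<Rightarrow> real) \<Rightarrow> real \<Rightarrow> real" where
  "memory_kernel k \<theta> t = (\<Sum>j = 1..k + 1. \<theta> j * gamma_kernel j t)"

definition subdiag_mat :: "nat \<Rightarrow> complex mat" where
  "subdiag_mat n = mat n n (\<lambda>(i, j). if i = j + 1 then 1 else 0)"

text \<open>The weights are indexed by \<open>1, \<dots>, k + 1\<close>, whereas vector and matrix indices start at \<open>0\<close>;
  hence the shift here and the use of \<open>unit_vec _ 0\<close> for the first basis vector.\<close>

definition theta_vec :: "nat \<Rightarrow> (nat \<Rightarrow> real) \<Rightarrow> complex vec" where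
  "theta_vec k \<theta> = vec (k + 1) (\<lambda>j. complex_of_real (\<theta> (j + 1)))"

definition dispersion_mat :: "nat \<Rightarrow> (nat \<Rightarrow> real) \<Rightarrow> complex \<Rightarrow> complex \<Rightarrow> complex mat" where
  "dispersion_mat k \<theta> z \<mu> =
     four_block_mat
       (z \<cdot>\<^sub>m 1\<^sub>m 1)                                  (\<mu> \<cdot>\<^sub>m mat_of_rows (k + 1) [theta_vec k \<theta>])
       (\<mu> \<cdot>\<^sub>m mat_of_cols (k + 1) [unit_vec (k + 1) 0])  ((z + 1) \<cdot>\<^sub>m 1\<^sub>m (k + 1) - subdiag_mat (k + 1))"

definition dispersion_poly :: "nat \<Rightarrow> (nat \<Rightarrow> real) \<Rightarrow> complex \<Rightarrow> complex \<Rightarrow> complex" where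
  "dispersion_poly k \<theta> z \<mu> = det (dispersion_mat k \<theta> z \<mu>)"

definition dispersion_roots :: "nat \<Rightarrow> (nat \<Rightarrow> real) \<Rightarrow> real \<Rightarrow> complex set" where
  "dispersion_roots k \<theta> \<xi> = {z. dispersion_poly k \<theta> z (\<i> * complex_of_real \<xi>) = 0}"

end

theory Submission
  imports Defs
begin

text \<open>Away from \<open>z = -1\<close> the dispersion relation is the scalar equation
  \<open>z = - \<xi>\<^sup>2 G(w)\<close>, where \<open>w = z + 1\<close> and \<open>G(w) = (\<Sum>j. \<theta> j / w ^ j)\<close> is the Laplace transform of the
  memory kernel at \<open>z\<close>. So \<open>Re z = - \<xi>\<^sup>2 Re G(w)\<close>, and everything rests on a positive lower bound
  for \<open>Re G\<close>, that is, on the kernel being positive definite in a quantified sense. Such a bound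
  holds because \<open>Re (1 / w) = Re w / \<bar>w\<bar>\<^sup>2\<close> is of order \<open>1 / \<bar>w\<bar>\<^sup>2\<close> when \<open>Re w\<close> is near or above
  \<open>1\<close>, and each further term \<open>1 / w ^ j\<close>, \<open>j \<ge> 2\<close>, is in modulus essentially at most
  \<open>1 / \<bar>w\<bar>\<^sup>2\<close>. The dominance of \<open>\<theta> 1\<close> over the sum of the other weights is strict, so the estimate
  survives on a half-plane \<open>Re w \<ge> b\<close> with some \<open>b < 1\<close>, and gives \<open>Re G(w) \<ge> \<delta> / \<bar>w\<bar>\<^sup>2\<close>
  (lemma \<open>Re_kernel_transform_ge\<close>).

  The same equation bounds \<open>w\<close>: since \<open>\<bar>w\<bar> \<bar>G(w)\<bar>\<close> is bounded on that half-plane, \<open>\<bar>z\<bar> \<bar>w\<bar>\<close> is at most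
  a multiple of \<open>\<xi>\<^sup>2\<close>, so that \<open>\<bar>w\<bar>\<^sup>2\<close> is at most a multiple of \<open>1 + \<xi>\<^sup>2\<close>. Together the two bounds
  yield \<open>Re z \<le> - c \<xi>\<^sup>2 / (1 + \<xi>\<^sup>2)\<close>. Roots with \<open>Re w < b\<close>, among them \<open>z = -1\<close>, already have
  real part below the negative constant \<open>b - 1\<close>.\<close>

definition kernel_transform :: "nat \<Rightarrow> (nat \<Rightarrow> real) \<Rightarrow> complex \<Rightarrow> complex" where
  "kernel_transform k \<theta> w = (\<Sum>j = 1..k + 1. of_real (\<theta> j) / w ^ j)"

text \<open>A vanishing determinant has a null vector \<open>(u, v)\<close>. The lower rows of the system are a
  two-term recursion, which forces \<open>v\<^sub>j = - \<mu> u / w ^ j\<close>; hence \<open>u \<noteq> 0\<close>, and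
  the first row divided by \<open>u\<close> is the scalar equation.\<close>

lemma dispersion_root_imp_scalar_equation:
  assumes det0: "dispersion_poly k \<theta> z \<mu> = 0" and w0: "z + 1 \<noteq> 0"
  shows "z = \<mu>\<^sup>2 * kernel_transform k \<theta> (z + 1)"
proof -
  define w where "w = z + 1"
  define D where "D = dispersion_mat k \<theta> z \<mu>"
  have D: "D \<in> carrier_mat (k + 2) (k + 2)"
    by (rule carrier_matI) (simp_all add: D_def dispersion_mat_def subdiag_mat_def)
  obtain x where x: "x \<in> carrier_vec (k + 2)" "x \<noteq> 0\<^sub>v (k + 2)" "D *\<^sub>v x = 0\<^sub>v (k + 2)"
    using det0 det_0_iff_vec_prod_zero[OF D] by (auto simp: dispersion_poly_def D_def)
  have row: "(\<Sum>j<k + 2. D $$ (i, j) * x $ j) = 0" if "i < k + 2" for i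
  proof -
    have "(D *\<^sub>v x) $ i = 0" using x(3) that by simp
    then show ?thesis
      using that x(1) D by (auto simp: scalar_prod_def lessThan_atLeast0)
  qed
  have D00: "D $$ (0, 0) = z"
    by (simp add: D_def dispersion_mat_def subdiag_mat_def)
  have D0S: "D $$ (0, Suc j) = \<mu> * of_real (\<theta> (Suc j))" if "j < Suc k" for j
    using that
    by (simp add: D_def dispersion_mat_def subdiag_mat_def theta_vec_def mat_of_rows_def)
  have DS0: "D $$ (Suc i, 0) = (if i = 0 then \<mu> else 0)" if "i < Suc k" for i
    using that
    by (simp add: D_def dispersion_mat_def subdiag_mat_def mat_of_cols_def unit_vec_def)
  have DSS: "D $$ (Suc i, Suc j) = (if i = j then w else if i = Suc j then -1 else 0)"
    if "i < Suc k" "j < Suc k" for i j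
    using that
    by (auto simp add: D_def dispersion_mat_def subdiag_mat_def w_def)
  have first: "z * x $ 0 + (\<Sum>j<Suc k. \<mu> * of_real (\<theta> (Suc j)) * x $ Suc j) = 0"
  proof -
    have "(\<Sum>j<k + 2. D $$ (0, j) * x $ j)
        = D $$ (0, 0) * x $ 0 + (\<Sum>j<Suc k. D $$ (0, Suc j) * x $ Suc j)"
      using sum.lessThan_Suc_shift[of "\<lambda>j. D $$ (0, j) * x $ j" "Suc k"]
      by (simp only: add_2_eq_Suc')
    also have "(\<Sum>j<Suc k. D $$ (0, Suc j) * x $ Suc j)
        = (\<Sum>j<Suc k. \<mu> * of_real (\<theta> (Suc j)) * x $ Suc j)"
      by (rule sum.cong) (simp_all only: lessThan_iff D0S)
    finally show ?thesis using row[of 0] D00 by simp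
  qed
  have lower: "(if i = 0 then \<mu> else 0) * x $ 0 +
      (\<Sum>j<Suc k. (if i = j then w else if i = Suc j then -1 else 0) * x $ Suc j) = 0"
    if i: "i < Suc k" for i
  proof -
    have "(\<Sum>j<k + 2. D $$ (Suc i, j) * x $ j)
        = D $$ (Suc i, 0) * x $ 0 + (\<Sum>j<Suc k. D $$ (Suc i, Suc j) * x $ Suc j)"
      using sum.lessThan_Suc_shift[of "\<lambda>j. D $$ (Suc i, j) * x $ j" "Suc k"]
      by (simp only: add_2_eq_Suc')
    also have "(\<Sum>j<Suc k. D $$ (Suc i, Suc j) * x $ Suc j)
        = (\<Sum>j<Suc k. (if i = j then w else if i = Suc j then -1 else 0) * x $ Suc j)"
      using i by (intro sum.cong refl) (simp only: lessThan_iff DSS)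
    finally show ?thesis using row[of "Suc i"] DS0[OF i] i by simp
  qed
  have rec0: "w * x $ 1 = - \<mu> * x $ 0"
  proof -
    have "(\<Sum>j<Suc k. (if 0 = j then w else if 0 = Suc j then -1 else 0) * x $ Suc j)
        = (\<Sum>j<Suc k. if j = 0 then w * x $ Suc j else 0)"
      by (intro sum.cong) auto
    also have "\<dots> = w * x $ 1" by (subst sum.delta) auto
    finally show ?thesis using lower[of 0] by (simp add: eq_neg_iff_add_eq_0 add.commute)
  qed
  have recS: "w * x $ (Suc (Suc i)) = x $ Suc i" if i: "Suc i < Suc k" for i
  proof -
    have "(\<Sum>j<Suc k. (if Suc i = j then w else if Suc i = Suc j then -1 else 0) * x $ Suc j)
        = (\<Sum>j<Suc k. (if j = Suc i then w * x $ Suc j else 0) + (if j = i then - x $ Suc j else 0))"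
      by (intro sum.cong) auto
    also have "\<dots> = w * x $ Suc (Suc i) - x $ Suc i"
      using i unfolding sum.distrib by (subst (1 2) sum.delta) auto
    finally show ?thesis using lower[OF i] by simp
  qed
  have w: "w \<noteq> 0" using w0 by (simp add: w_def)
  have v: "x $ Suc i = - \<mu> * x $ 0 / w ^ Suc i" if "i < Suc k" for i
    using that
  proof (induction i)
    case 0
    then show ?case using rec0 w by (simp add: field_simps)
  next
    case (Suc i)
    then have "w * x $ (Suc (Suc i)) = - \<mu> * x $ 0 / w ^ Suc i" using recS[of i] by simp
    then have "x $ (Suc (Suc i)) = - \<mu> * x $ 0 / w ^ Suc i / w"
      using w by (metis nonzero_mult_div_cancel_left)
    then show ?case by (simp add: mult_ac)
  qed
  have u: "x $ 0 \<noteq> 0"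
  proof
    assume u0: "x $ 0 = 0"
    have "x $ i = 0" if "i < k + 2" for i
      using that u0 v by (cases i) auto
    then have "x = 0\<^sub>v (k + 2)" using x(1) by (intro eq_vecI) auto
    with x(2) show False ..
  qed
  have "(\<Sum>j<Suc k. \<mu> * of_real (\<theta> (Suc j)) * x $ Suc j)
      = (\<Sum>j<Suc k. - (\<mu>\<^sup>2 * x $ 0) * (of_real (\<theta> (Suc j)) / w ^ Suc j))"
    using v by (intro sum.cong) (auto simp: power2_eq_square)
  also have "\<dots> = - (\<mu>\<^sup>2 * x $ 0) * (\<Sum>j<Suc k. of_real (\<theta> (Suc j)) / w ^ Suc j)"
    by (simp only: sum_distrib_left)
  also have "(\<Sum>j<Suc k. of_real (\<theta> (Suc j)) / w ^ Suc j) = kernel_transform k \<theta> w"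
    unfolding kernel_transform_def
    by (rule sum.reindex_bij_witness[of _ "\<lambda>j. j - 1" Suc]) auto
  finally have "x $ 0 * z = x $ 0 * (\<mu>\<^sup>2 * kernel_transform k \<theta> w)"
    using first by (simp add: algebra_simps)
  with u show ?thesis by (simp add: w_def)
qed

lemma inverse_power_le_uniform:
  fixes b r :: real
  assumes "0 < b" "b \<le> 1" "b \<le> r" "n \<le> k"
  shows "1 / r ^ n \<le> 1 / b ^ k"
proof (rule divide_left_mono)
  have "b ^ k \<le> b ^ n" using assms by (intro power_decreasing) auto
  also have "\<dots> \<le> r ^ n" using assms by (intro power_mono) auto
  finally show "b ^ k \<le> r ^ n" .
qed (use assms in auto)

text \<open>The first term contributes \<open>\<theta> 1 Re w / \<bar>w\<bar>\<^sup>2\<close> to the real part, and the others are estimated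
  by their moduli. A factor \<open>1 / \<bar>w\<bar>\<^sup>2\<close> can be split off each of them, and the remaining
  power of \<open>1 / \<bar>w\<bar>\<close> is bounded by \<open>1 / b ^ k\<close>.\<close>

lemma Re_kernel_transform_ge:
  assumes b: "0 < b" "b \<le> 1" and w: "b \<le> Re w"
    and nonneg: "\<And>j. j \<in> {1..k + 1} \<Longrightarrow> \<theta> j \<ge> 0"
  shows "(\<theta> 1 * b - (\<Sum>j = 2..k + 1. \<theta> j) / b ^ k) / (cmod w)\<^sup>2 \<le> Re (kernel_transform k \<theta> w)"
proof -
  define r where "r = cmod w"
  have r: "b \<le> r" using w complex_Re_le_cmod[of w] by (simp add: r_def)
  have rpos: "r > 0" using r b by simp
  have "\<theta> 1 * b / r\<^sup>2 \<le> \<theta> 1 * Re w / r\<^sup>2"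
    using w nonneg[of 1] by (intro divide_right_mono mult_left_mono) auto
  also have "\<dots> = Re (of_real (\<theta> 1) / w ^ 1)"
    by (simp add: r_def Re_divide cmod_power2)
  finally have first: "\<theta> 1 * b / r\<^sup>2 \<le> Re (of_real (\<theta> 1) / w ^ 1)" .
  have term_ge: "- (\<theta> j / b ^ k / r\<^sup>2) \<le> Re (of_real (\<theta> j) / w ^ j)" if j: "j \<in> {2..k + 1}" for j
  proof -
    have "\<theta> j \<ge> 0" using j nonneg by auto
    have "j = j - 2 + 2" using j unfolding atLeastAtMost_iff by linarith
    then have "r ^ j = r ^ (j - 2) * r\<^sup>2" by (metis power_add)
    then have "cmod (of_real (\<theta> j) / w ^ j) = \<theta> j * (1 / r ^ (j - 2)) / r\<^sup>2"
      using \<open>\<theta> j \<ge> 0\<close> by (simp add: norm_divide norm_power r_def)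
    also have "\<dots> \<le> \<theta> j * (1 / b ^ k) / r\<^sup>2"
      using j b r \<open>\<theta> j \<ge> 0\<close>
      by (intro divide_right_mono mult_left_mono inverse_power_le_uniform) auto
    finally show ?thesis
      using abs_Re_le_cmod[of "of_real (\<theta> j) / w ^ j"] by simp
  qed
  have "(\<theta> 1 * b - (\<Sum>j = 2..k + 1. \<theta> j) / b ^ k) / r\<^sup>2
      = \<theta> 1 * b / r\<^sup>2 + (\<Sum>j = 2..k + 1. - (\<theta> j / b ^ k / r\<^sup>2))"
    by (simp add: diff_divide_distrib sum_negf sum_divide_distrib del: sum.cl_ivl_Suc)
  also have "\<dots> \<le> Re (of_real (\<theta> 1) / w ^ 1) + (\<Sum>j = 2..k + 1. Re (of_real (\<theta> j) / w ^ j))"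
    using first term_ge by (intro add_mono sum_mono) auto
  also have "\<dots> = (\<Sum>j = 1..k + 1. Re (of_real (\<theta> j) / w ^ j))"
    by (subst (2) sum.atLeast_Suc_atMost) (simp_all only: Suc_1 le_add2)
  also have "\<dots> = Re (kernel_transform k \<theta> w)"
    by (simp only: kernel_transform_def Re_sum)
  finally show ?thesis by (simp add: r_def)
qed

lemma norm_mult_kernel_transform_le:
  assumes b: "0 < b" "b \<le> 1" and w: "b \<le> cmod w"
    and nonneg: "\<And>j. j \<in> {1..k + 1} \<Longrightarrow> \<theta> j \<ge> 0"
  shows "cmod w * cmod (kernel_transform k \<theta> w) \<le> (\<Sum>j = 1..k + 1. \<theta> j) / b ^ k"
proof -
  define r where "r = cmod w"
  have "b \<le> r" using w by (simp add: r_def)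
  then have r: "b \<le> r" "r > 0" using b by linarith+
  have term_le: "r * cmod (of_real (\<theta> j) / w ^ j) \<le> \<theta> j / b ^ k" if j: "j \<in> {1..k + 1}" for j
  proof -
    have "\<theta> j \<ge> 0" using j nonneg by auto
    have "r ^ j = r * r ^ (j - 1)"
      using j by (cases j) auto
    then have "r * cmod (of_real (\<theta> j) / w ^ j) = \<theta> j * (1 / r ^ (j - 1))"
      using \<open>\<theta> j \<ge> 0\<close> r by (simp add: norm_divide norm_power flip: r_def)
    also have "\<dots> \<le> \<theta> j * (1 / b ^ k)"
      using j b r \<open>\<theta> j \<ge> 0\<close> by (intro mult_left_mono inverse_power_le_uniform) auto
    finally show ?thesis by simp
  qed
  have "r * cmod (kernel_transform k \<theta> w) \<le> r * (\<Sum>j = 1..k + 1. cmod (of_real (\<theta> j) / w ^ j))"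
    unfolding kernel_transform_def using r by (intro mult_left_mono norm_sum) auto
  also have "\<dots> \<le> (\<Sum>j = 1..k + 1. \<theta> j / b ^ k)"
    unfolding sum_distrib_left using term_le by (intro sum_mono) auto
  finally show ?thesis by (simp only: r_def sum_divide_distrib)
qed

text \<open>The margin in the strict dominance condition is spent on moving the half-plane slightly to
  the left of \<open>Re w = 1\<close>.\<close>

lemma exists_half_plane_with_dominance:
  fixes t s :: real
  assumes "s < t"
  shows "\<exists>b. 0 < b \<and> b < 1 \<and> 0 < t * b - s / b ^ k"
proof -
  have "((\<lambda>b::real. t * b - s / b ^ k) \<longlongrightarrow> t * 1 - s / 1 ^ k) (at_left 1)"
    by (intro tendsto_intros) auto
  then have "eventually (\<lambda>b::real. 0 < t * b - s / b ^ k) (at_left 1)"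
    using assms by (intro order_tendstoD(1)) auto
  moreover have "eventually (\<lambda>b::real. b \<in> {0<..<1}) (at_left 1)"
    by (rule eventually_at_leftI[of 0]) auto
  ultimately have "eventually (\<lambda>b::real. 0 < b \<and> b < 1 \<and> 0 < t * b - s / b ^ k) (at_left 1)"
    by eventually_elim auto
  then show ?thesis
    using eventually_happens trivial_limit_at_left_real by blast
qed

theorem theorem1p2:
  fixes k :: nat and \<theta> :: "nat \<Rightarrow> real" and g :: "real \<Rightarrow> real"
  assumes "k \<ge> 1"
    and "\<And>t. t \<ge> 0 \<Longrightarrow> g t = memory_kernel k \<theta> t"
    and "\<theta> 1 > 0"
    and "\<And>j. j \<in> {1..k + 1} \<Longrightarrow> \<theta> j \<ge> 0"
    and "(\<Sum>j = 2..k + 1. \<theta> j) < \<theta> 1"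
  shows "\<exists>c0::real. c0 > 0 \<and>
    (\<forall>\<xi>::real. \<forall>z \<in> dispersion_roots k \<theta> \<xi>. Re z \<le> - (c0 * \<bar>\<xi>\<bar>\<^sup>2 / (1 + \<bar>\<xi>\<bar>\<^sup>2)))"
proof -
  obtain b where b: "0 < b" "b < 1" and "0 < \<theta> 1 * b - (\<Sum>j = 2..k + 1. \<theta> j) / b ^ k"
    using exists_half_plane_with_dominance[OF assms(5)] by blast
  define \<delta> where "\<delta> = \<theta> 1 * b - (\<Sum>j = 2..k + 1. \<theta> j) / b ^ k"
  define M where "M = (\<Sum>j = 1..k + 1. \<theta> j) / b ^ k"
  define C where "C = max 1 (2 * M)"
  define c0 where "c0 = min (1 - b) (\<delta> / C)"
  have \<delta>: "\<delta> > 0" unfolding \<delta>_def by fact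
  have C: "C \<ge> 1" "C \<ge> 2 * M" by (simp_all add: C_def)
  have c0: "c0 > 0" using b \<delta> C by (simp add: c0_def)
  have "Re z \<le> - (c0 * \<xi>\<^sup>2 / (1 + \<xi>\<^sup>2))" if root: "z \<in> dispersion_roots k \<theta> \<xi>" for \<xi> z
  proof (cases "Re (z + 1) < b")
    case True
    have "\<xi>\<^sup>2 / (1 + \<xi>\<^sup>2) \<le> 1"
      by (simp add: divide_le_eq add_pos_nonneg)
    then have "c0 * (\<xi>\<^sup>2 / (1 + \<xi>\<^sup>2)) \<le> c0 * 1"
      using c0 by (intro mult_left_mono) auto
    also have "\<dots> \<le> 1 - b" by (simp add: c0_def)
    finally show ?thesis using True by simp
  next
    case False
    define w where "w = z + 1"
    define r where "r = cmod w"
    have w: "b \<le> Re w" using False by (simp add: w_def)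
    have r: "b \<le> r" using w complex_Re_le_cmod[of w] by (simp add: r_def)
    have "z = (\<i> * of_real \<xi>)\<^sup>2 * kernel_transform k \<theta> w"
      unfolding w_def
    proof (rule dispersion_root_imp_scalar_equation)
      show "dispersion_poly k \<theta> z (\<i> * of_real \<xi>) = 0"
        using root by (simp add: dispersion_roots_def)
      show "z + 1 \<noteq> 0" using w b unfolding w_def by force
    qed
    then have z: "z = - of_real (\<xi>\<^sup>2) * kernel_transform k \<theta> w"
      by (simp add: power_mult_distrib)
    have "r - 1 \<le> cmod z"
      using norm_triangle_ineq[of z 1] by (simp add: r_def w_def)
    then have "r * (r - 1) \<le> r * cmod z"
      using r b by (intro mult_left_mono) auto
    also have "\<dots> = \<xi>\<^sup>2 * (r * cmod (kernel_transform k \<theta> w))"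
      by (subst z) (simp add: norm_mult norm_power)
    also have "\<dots> \<le> \<xi>\<^sup>2 * M"
      using norm_mult_kernel_transform_le[of b w k \<theta>] b r assms(4)
      by (intro mult_left_mono) (auto simp: M_def r_def)
    finally have "r * (r - 1) \<le> \<xi>\<^sup>2 * M" .
    \<comment> \<open>The linear term is absorbed by \<open>2 r \<le> r\<^sup>2 + 1\<close>.\<close>
    moreover have "0 \<le> (r - 1)\<^sup>2" by simp
    ultimately have "r\<^sup>2 \<le> \<xi>\<^sup>2 * (2 * M) + 1"
      by (simp add: power2_eq_square algebra_simps)
    also have "\<dots> \<le> \<xi>\<^sup>2 * C + C"
      using C by (intro add_mono mult_left_mono) auto
    finally have r2: "r\<^sup>2 \<le> C * (1 + \<xi>\<^sup>2)" by (simp add: algebra_simps)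
    have "c0 * \<xi>\<^sup>2 / (1 + \<xi>\<^sup>2) \<le> \<delta> / C * \<xi>\<^sup>2 / (1 + \<xi>\<^sup>2)"
      by (intro divide_right_mono mult_right_mono) (auto simp: c0_def)
    also have "\<dots> = \<xi>\<^sup>2 * (\<delta> / (C * (1 + \<xi>\<^sup>2)))" by simp
    also have "\<dots> \<le> \<xi>\<^sup>2 * (\<delta> / r\<^sup>2)"
      using r2 r b C \<delta> by (intro mult_left_mono divide_left_mono mult_pos_pos add_pos_nonneg) auto
    also have "\<dots> \<le> \<xi>\<^sup>2 * Re (kernel_transform k \<theta> w)"
      using Re_kernel_transform_ge[of b w k \<theta>] b w assms(4)
      by (intro mult_left_mono) (auto simp: \<delta>_def r_def)
    also have "\<dots> = - Re z"
      by (subst z) simp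
    finally show ?thesis by simp
  qed
  then show ?thesis using c0 by (intro exI[of _ c0]) simp
qed

end
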